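(* (a) $\Gamma$ has non-linear $5$-cliques if and only if $q=2^n$ with $n$ odd. (b) If $n$ is odd, every non-linear $5$-clique of $\Gamma$ is contained in a $6$-clique of $\Gamma$. (c) $\Gamma$ has no non-linear $k$-cliques with $k>6$.
   Context: Let $q=2^n$ and let $Q_0\cong Q(4,q)$ be the parabolic quadric generalized quadrangle in $\mathrm{PG}(4,q)$. An elliptic ovoid of $Q_0$ is a set $X=S\cap Q_0$ where $S$ is a $3$-dimensional projective subspace meeting $Q_0$ in an elliptic quadric $Q^-(3,q)$. Two distinct elliptic ovoids meet in one point (then they are tangent) or in a conic. A rosette based at $p\in Q_0$ is a set of $q$ elliptic ovoids pairwise meeting exactly in $\{p\}$. $\Gamma$ is the graph whose vertices are the elliptic ovoids of $Q_0$, adjacent iff distinct and tangent. A clique of $\Gamma$ is linear if contained in a rosette, non-linear otherwise; a $k$-clique has $k$ vertices. *)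

theory Defs
  imports "HOL-Analysis.Finite_Cartesian_Product"
begin

text \<open>Vectors of the underlying 5-dimensional space V(5,q) over a finite field 'a
  (of order q = 2^n).  Projective points of PG(4,q) are represented by the sets
  {c v | c nonzero} for nonzero v.\<close>

definition vsmult :: "'a::field \<Rightarrow> 'a ^ 5 \<Rightarrow> 'a ^ 5" where
  "vsmult c v = (\<chi> i. c * v $ i)"

definition ppoint :: "'a::field ^ 5 \<Rightarrow> ('a ^ 5) set" where
  "ppoint v = {vsmult c v | c. c \<noteq> 0}"

definition qf :: "'a::field ^ 5 \<Rightarrow> 'a" where
  "qf x = (x $ 0)^2 + x $ 1 * x $ 2 + x $ 3 * x $ 4"

definition polar :: "'a::field ^ 5 \<Rightarrow> 'a ^ 5 \<Rightarrow> 'a" where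
  "polar x y = qf (x + y) - qf x - qf y"

definition Q0 :: "('a::field ^ 5) set set" where
  "Q0 = {ppoint v | v. v \<noteq> 0 \<and> qf v = 0}"

text \<open>A 3-dimensional projective subspace (solid) of PG(4,q), as a 4-dimensional
  vector subspace: the kernel of a nonzero linear functional.\<close>

definition solid :: "'a::field ^ 5 \<Rightarrow> ('a ^ 5) set" where
  "solid a = {x. (\<Sum>i\<in>UNIV. a $ i * x $ i) = 0}"

text \<open>The solid S meets Q_0 in an elliptic quadric Q^-(3,q): the quadric Q restricted
  to S is nonsingular and contains no line.\<close>

definition nonsingular_on :: "('a::field ^ 5) set \<Rightarrow> bool" where
  "nonsingular_on W \<longleftrightarrow>
     (\<forall>v\<in>W. v \<noteq> 0 \<and> qf v = 0 \<longrightarrow> (\<exists>w\<in>W. polar v w \<noteq> 0))"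

definition contains_line :: "('a::field ^ 5) set \<Rightarrow> bool" where
  "contains_line W \<longleftrightarrow>
     (\<exists>u\<in>W. \<exists>v\<in>W. (\<forall>\<alpha> \<beta>. vsmult \<alpha> u + vsmult \<beta> v = 0 \<longrightarrow> \<alpha> = 0 \<and> \<beta> = 0)
        \<and> (\<forall>\<alpha> \<beta>. qf (vsmult \<alpha> u + vsmult \<beta> v) = 0))"

definition elliptic_solid :: "('a::field ^ 5) set \<Rightarrow> bool" where
  "elliptic_solid W \<longleftrightarrow> nonsingular_on W \<and> \<not> contains_line W"

definition ell_ovoids :: "('a::field ^ 5) set set set" where
  "ell_ovoids = {{P \<in> Q0. P \<subseteq> solid a} | a. a \<noteq> 0 \<and> elliptic_solid (solid a)}"

definition adjacent :: "('a::field ^ 5) set set \<Rightarrow> ('a ^ 5) set set \<Rightarrow> bool" where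
  "adjacent X Y \<longleftrightarrow> X \<in> ell_ovoids \<and> Y \<in> ell_ovoids \<and> X \<noteq> Y \<and> card (X \<inter> Y) = 1"

definition clique :: "('a::field ^ 5) set set set \<Rightarrow> bool" where
  "clique C \<longleftrightarrow> C \<subseteq> ell_ovoids \<and> (\<forall>X\<in>C. \<forall>Y\<in>C. X \<noteq> Y \<longrightarrow> adjacent X Y)"

definition rosette :: "('a::{field,finite} ^ 5) set \<Rightarrow> ('a ^ 5) set set set \<Rightarrow> bool" where
  "rosette p R \<longleftrightarrow> p \<in> Q0 \<and> R \<subseteq> ell_ovoids \<and> card R = CARD('a)
     \<and> (\<forall>X\<in>R. \<forall>Y\<in>R. X \<noteq> Y \<longrightarrow> X \<inter> Y = {p})"

definition linear_clique :: "('a::{field,finite} ^ 5) set set set \<Rightarrow> bool" where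
  "linear_clique C \<longleftrightarrow> clique C \<and> (\<exists>p R. rosette p R \<and> C \<subseteq> R)"

definition nonlinear_clique :: "('a::{field,finite} ^ 5) set set set \<Rightarrow> bool" where
  "nonlinear_clique C \<longleftrightarrow> clique C \<and> \<not> (\<exists>p R. rosette p R \<and> C \<subseteq> R)"

end

theory Submission
  imports Defs "HOL-Computational_Algebra.Polynomial"
begin

text \<open>An elliptic solid misses the nucleus (1,0,0,0,0), so its covector a can be normalised to
  a_0 = 1; write B for the polar form.  Two elliptic solids a, b are tangent iff
  qf a + qf b = B(a,b) + B(a,b)^2, because the plane in which they meet then has a singular
  radical \<open>tangent_pt a b\<close>.  Adding this equation over three pairwise tangent ovoids shows that
  s = B(a,b) + B(a,c) + B(b,c) satisfies s = s^2, and s is the inner product of the base points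
  \<open>tangent_pt a b\<close> and \<open>tangent_pt a c\<close>.  If s = 0, these coincide, since the quadric in the solid
  a has no lines, and the whole clique lies on the affine line through a and b, hence in a
  rosette.  So in a non-linear clique the base points seen from a fixed member a are represented
  by singular vectors u_i of the solid a with all mutual inner products 1.

  For five ovoids this gives u_1, ..., u_4 on which qf is the sum of the x_i x_j, i < j.  If n is
  even, a primitive cube root of unity w produces the totally singular line spanned by
  u_1 + w u_2 + w^2 u_3 and u_2 + w^2 u_3 + w u_4, which is impossible.  A further u must equal
  u_1 + u_2 + u_3 + u_4, as the difference is singular and orthogonal to all u_i; hence the sixth
  ovoid can only be the sum of the five covectors, and that one is indeed tangent to all of them.
  For n odd, covectors over the prime field give an example.\<close>

section \<open>Vectors, the quadratic form and characteristic two\<close>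

lemma exhaust_5:
  fixes x :: 5
  shows "x = 0 \<or> x = 1 \<or> x = 2 \<or> x = 3 \<or> x = 4"
proof (induct x)
  case (of_int z)
  then have "z = 0 \<or> z = 1 \<or> z = 2 \<or> z = 3 \<or> z = 4"
    by simp arith
  then show ?case by auto
qed

lemma UNIV_5: "(UNIV :: 5 set) = {0, 1, 2, 3, 4}"
  using exhaust_5 by auto

lemma vec5_eq_iff:
  fixes x y :: "'a ^ 5"
  shows "x = y \<longleftrightarrow> x $ 0 = y $ 0 \<and> x $ 1 = y $ 1 \<and> x $ 2 = y $ 2 \<and> x $ 3 = y $ 3 \<and> x $ 4 = y $ 4"
proof
  assume *: "x $ 0 = y $ 0 \<and> x $ 1 = y $ 1 \<and> x $ 2 = y $ 2 \<and> x $ 3 = y $ 3 \<and> x $ 4 = y $ 4"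
  have "x $ i = y $ i" for i
    using exhaust_5[of i] * by (elim disjE conjE) (simp_all only:)
  then show "x = y" by (simp add: vec_eq_iff)
qed (simp only:)

definition vec5 :: "'a \<Rightarrow> 'a \<Rightarrow> 'a \<Rightarrow> 'a \<Rightarrow> 'a \<Rightarrow> 'a ^ 5" where
  "vec5 x0 x1 x2 x3 x4 =
     (\<chi> i. if i = 0 then x0 else if i = 1 then x1 else if i = 2 then x2 else if i = 3 then x3 else x4)"

lemma vec5_nth [simp]:
  "vec5 x0 x1 x2 x3 x4 $ 0 = x0" "vec5 x0 x1 x2 x3 x4 $ 1 = x1" "vec5 x0 x1 x2 x3 x4 $ 2 = x2"
  "vec5 x0 x1 x2 x3 x4 $ 3 = x3" "vec5 x0 x1 x2 x3 x4 $ 4 = x4"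
  by (simp_all add: vec5_def)

lemma vsmult_nth [simp]: "vsmult c x $ i = c * x $ i"
  by (simp add: vsmult_def)

definition dot :: "'a::field ^ 5 \<Rightarrow> 'a ^ 5 \<Rightarrow> 'a" where
  "dot a x = a $ 0 * x $ 0 + a $ 1 * x $ 1 + a $ 2 * x $ 2 + a $ 3 * x $ 3 + a $ 4 * x $ 4"

lemma sum_5: "sum f (UNIV :: 5 set) = f 0 + f 1 + f 2 + f 3 + (f 4 :: 'a::comm_monoid_add)"
  unfolding UNIV_5 by (simp add: add.assoc)

lemma mem_solid: "x \<in> solid a \<longleftrightarrow> dot a x = 0"
  by (simp only: solid_def dot_def sum_5 mem_Collect_eq)

lemma dot_linear:
  "dot a (x + y) = dot a x + dot a y" "dot a (vsmult c x) = c * dot a x"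
  "dot (a + b) x = dot a x + dot b x" "dot (vsmult c a) x = c * dot a x"
  by (simp_all add: dot_def algebra_simps)

text \<open>Characteristic 2 is a property of the particular field type; a locale lets the
  cancellation laws of that field act as rewrite rules.\<close>

locale char2_field =
  fixes ty :: "'a::{field,finite} itself"
  assumes two_eq_0 [simp]: "(2::'a) = 0"
begin

lemma add_self [simp]: "x + x = (0::'a)"
  by (metis mult_2 mult_zero_left two_eq_0)

lemma add_self_left [simp]: "x + (x + y) = (y::'a)"
  by (simp flip: add.assoc)

lemma numeral_Bit [simp]: "numeral (num.Bit0 k) = (0::'a)" "numeral (num.Bit1 k) = (1::'a)"
  by (simp_all only: numeral.simps add_self add_0)

lemma minus_eq [simp]: "- x = (x::'a)"
  by (simp add: minus_unique)

lemma diff_eq_add [simp]: "x - y = x + (y::'a)"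
  by (metis minus_eq add_uminus_conv_diff)

lemma add_eq_0_iff_eq: "x + y = 0 \<longleftrightarrow> x = (y::'a)"
  by (metis add_self add_left_cancel)

text \<open>After multiplying out and sorting, equal summands are neighbours and cancel by
  \<open>add_self\<close> and \<open>add_self_left\<close>; polynomial identities in characteristic
  2 are checked this way.\<close>

lemmas char2_simps = distrib_left distrib_right add_ac mult_ac power2_eq_square

lemma vec_add_self [simp]: "x + x = (0::'a ^ 5)"
  by (simp only: vec_eq_iff vector_add_component add_self zero_index) simp

lemma vec_add_self_left [simp]: "x + (x + y) = (y::'a ^ 5)"
  by (simp flip: add.assoc)

lemma vec_add_eq_0_iff: "x + y = 0 \<longleftrightarrow> x = (y::'a ^ 5)"
  by (simp add: vec_eq_iff add_eq_0_iff_eq)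

text \<open>Squaring is additive, so the square of coordinate 0 drops out and the nucleus is
  orthogonal to every vector.\<close>

lemma polar_eq:
  "polar x y = x $ 1 * y $ 2 + x $ 2 * y $ 1 + x $ 3 * y $ 4 + x $ 4 * (y :: 'a ^ 5) $ 3"
  unfolding polar_def qf_def by (simp add: char2_simps)

lemma polar_bilinear:
  fixes x y z :: "'a ^ 5"
  shows "polar (x + y) z = polar x z + polar y z" "polar x (y + z) = polar x y + polar x z"
    "polar (vsmult c x) y = c * polar x y" "polar x (vsmult c y) = c * polar x y"
  by (simp_all add: polar_eq algebra_simps)

lemma polar_self [simp]: "polar x x = (0::'a)"
  by (simp add: polar_eq mult.commute)

lemma polar_zero [simp]: "polar x 0 = (0::'a)" "polar 0 x = (0::'a)"
  by (simp_all add: polar_eq)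

lemma polar_commute: "polar x y = polar y (x :: 'a ^ 5)"
  by (simp add: polar_eq algebra_simps)

lemma qf_add: "qf (x + y) = qf x + qf y + polar x (y :: 'a ^ 5)"
  unfolding polar_def using add_self by (simp add: algebra_simps)

lemma qf_vsmult: "qf (vsmult c x) = c\<^sup>2 * qf (x :: 'a ^ 5)"
  by (simp add: qf_def algebra_simps power2_eq_square)

text \<open>Squaring is injective, since x^2 + y^2 = (x + y)^2, and an injective self-map of a
  finite set is onto.\<close>

lemma ex_sqrt: "\<exists>y. y\<^sup>2 = (x::'a)"
proof -
  have "inj (\<lambda>y::'a. y\<^sup>2)"
  proof (rule injI)
    fix x y :: 'a assume "x\<^sup>2 = y\<^sup>2"
    then have "(x + y)\<^sup>2 = 0" by (simp add: char2_simps)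
    then show "x = y" by (simp add: add_eq_0_iff_eq)
  qed
  then have "surj (\<lambda>y::'a. y\<^sup>2)" by (simp add: finite_UNIV_inj_surj)
  then show ?thesis by (metis surjD)
qed

end

section \<open>Elliptic ovoids as covectors\<close>

text \<open>The last four coordinates are those of \<open>a + b\<close> with 1, 2 and 3, 4
  exchanged, which turns the polar form into the functional of \<open>a + b\<close>. For
  \<open>a $ 0 = b $ 0 = 1\<close>, coordinate 0 places the vector in both solids.\<close>

definition tangent_pt :: "'a::field ^ 5 \<Rightarrow> 'a ^ 5 \<Rightarrow> 'a ^ 5" where
  "tangent_pt a b = vec5 (polar a b) (a $ 2 + b $ 2) (a $ 1 + b $ 1) (a $ 4 + b $ 4) (a $ 3 + b $ 3)"

text \<open>Absence of lines in the form used throughout: orthogonal singular vectors of the solid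
  are proportional. Nonsingularity comes from \<open>a $ 0 = 1\<close>, by
  \<open>solid_polar_nondegenerate\<close>.\<close>

definition elliptic_covector :: "'a::field ^ 5 \<Rightarrow> bool" where
  "elliptic_covector a \<longleftrightarrow> a $ 0 = 1 \<and>
     (\<forall>x\<in>solid a. \<forall>y\<in>solid a. qf x = 0 \<and> qf y = 0 \<and> polar x y = 0 \<and> x \<noteq> 0 \<longrightarrow> (\<exists>c. y = vsmult c x))"

definition ovoid :: "'a::field ^ 5 \<Rightarrow> ('a ^ 5) set set" where
  "ovoid a = {P \<in> Q0. P \<subseteq> solid a}"

lemma vsmult_simps [simp]:
  "vsmult c (0 :: 'a::field ^ 5) = 0" "vsmult 0 x = 0" "vsmult 1 x = x"
  "vsmult c (vsmult d x) = vsmult (c * d) x"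
  by (simp_all add: vec_eq_iff mult.assoc)

lemma vsmult_eq_0_iff: "vsmult c x = 0 \<longleftrightarrow> c = 0 \<or> x = 0"
  by (auto simp: vec_eq_iff)

lemma mem_ppoint_self: "v \<in> ppoint v"
  unfolding ppoint_def by (metis (mono_tags, lifting) mem_Collect_eq vsmult_simps(3) zero_neq_one)

lemma ppoint_eq_iff: "ppoint v = ppoint w \<longleftrightarrow> (\<exists>c. c \<noteq> 0 \<and> v = vsmult c w)"
proof
  assume "ppoint v = ppoint w"
  then show "\<exists>c. c \<noteq> 0 \<and> v = vsmult c w"
    using mem_ppoint_self[of v] by (auto simp: ppoint_def)
next
  assume "\<exists>c. c \<noteq> 0 \<and> v = vsmult c w"
  then obtain c where c: "c \<noteq> 0" "v = vsmult c w" by blast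
  have "vsmult d v = vsmult (d * c) w" "vsmult d w = vsmult (d / c) v" for d
    using c by simp_all
  then show "ppoint v = ppoint w"
    unfolding ppoint_def using c(1) by (auto; metis divide_eq_0_iff mult_eq_0_iff)
qed

context char2_field
begin

lemma ppoint_mem_ovoid: "ppoint v \<in> ovoid a \<longleftrightarrow> v \<noteq> 0 \<and> qf v = 0 \<and> v \<in> solid (a :: 'a ^ 5)"
proof -
  have "ppoint v \<subseteq> solid a \<longleftrightarrow> v \<in> solid a"
    using mem_ppoint_self[of v] by (auto simp: ppoint_def mem_solid dot_linear)
  moreover have "ppoint v \<in> Q0 \<longleftrightarrow> v \<noteq> 0 \<and> qf v = 0"
  proof
    assume "ppoint v \<in> Q0"
    then obtain w c where "v = vsmult c w" "c \<noteq> 0" "w \<noteq> 0" "qf w = 0"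
      by (auto simp: Q0_def ppoint_eq_iff)
    then show "v \<noteq> 0 \<and> qf v = 0" by (simp add: qf_vsmult vsmult_eq_0_iff)
  qed (auto simp: Q0_def)
  ultimately show ?thesis by (auto simp: ovoid_def)
qed

lemma ovoid_cases:
  assumes "P \<in> ovoid (a :: 'a ^ 5)"
  obtains v where "P = ppoint v" "v \<noteq> 0" "qf v = 0" "v \<in> solid a"
  using assms ppoint_mem_ovoid by (auto simp: ovoid_def Q0_def)

section \<open>The base point of a pair of covectors\<close>

lemma tangent_pt_mem_solid:
  fixes a b :: "'a ^ 5"
  assumes "a $ 0 = 1" "b $ 0 = 1"
  shows "tangent_pt a b \<in> solid a" "tangent_pt a b \<in> solid b"
  using assms by (simp_all add: mem_solid dot_def tangent_pt_def polar_eq char2_simps)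

text \<open>The right side vanishes on the plane common to both solids, so the vector lies in the
  radical of that plane.\<close>

lemma polar_tangent_pt:
  fixes a b :: "'a ^ 5"
  assumes "a $ 0 = 1" "b $ 0 = 1"
  shows "polar (tangent_pt a b) x = dot (a + b) x"
  using assms by (simp add: dot_def tangent_pt_def polar_eq char2_simps)

lemma qf_tangent_pt:
  fixes a b :: "'a ^ 5"
  assumes "a $ 0 = 1" "b $ 0 = 1"
  shows "qf (tangent_pt a b) = (polar a b)\<^sup>2 + polar a b + qf a + qf b"
  using assms by (simp add: qf_def tangent_pt_def polar_eq char2_simps)

text \<open>The exchange of coordinates in \<open>tangent_pt\<close> preserves the polar form, so
  the left side is \<open>polar (a + b) (a + c)\<close>.\<close>

lemma polar_tangent_pt_tangent_pt:
  fixes a b c :: "'a ^ 5"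
  shows "polar (tangent_pt a b) (tangent_pt a c) = polar a b + polar a c + polar b c"
  by (simp add: tangent_pt_def polar_eq char2_simps)

lemma tangent_pt_commute: "tangent_pt a b = tangent_pt b (a :: 'a ^ 5)"
  by (simp add: tangent_pt_def add.commute polar_commute)

lemma tangent_pt_eq_0:
  fixes a b :: "'a ^ 5"
  assumes "a $ 0 = 1" "b $ 0 = 1" "tangent_pt a b = 0"
  shows "a = b"
  using assms by (simp add: tangent_pt_def vec5_eq_iff add_eq_0_iff_eq)

text \<open>The four vectors \<open>w\<close> form a basis of the solid. Orthogonality to them kills
  the last four coordinates of \<open>v\<close>, which leaves a multiple of the nucleus, and the
  nucleus is outside the solid.\<close>

lemma solid_polar_nondegenerate:
  fixes a v :: "'a ^ 5"
  assumes a: "a $ 0 = 1" and v: "v \<in> solid a" "v \<noteq> 0"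
  shows "\<exists>w\<in>solid a. polar v w \<noteq> 0"
proof (rule ccontr)
  assume *: "\<not> ?thesis"
  have w: "vec5 (a $ 2) 0 1 0 0 \<in> solid a" "vec5 (a $ 1) 1 0 0 0 \<in> solid a"
    "vec5 (a $ 4) 0 0 0 1 \<in> solid a" "vec5 (a $ 3) 0 0 1 0 \<in> solid a"
    using a by (simp_all add: mem_solid dot_def)
  have "v $ 1 = 0" "v $ 2 = 0" "v $ 3 = 0" "v $ 4 = 0"
    using *[simplified, rule_format, OF w(1)] *[simplified, rule_format, OF w(2)]
      *[simplified, rule_format, OF w(3)] *[simplified, rule_format, OF w(4)]
    by (simp_all add: polar_eq)
  then show False using v a by (simp add: mem_solid dot_def vec5_eq_iff)
qed

text \<open>If coordinate 0 vanished, the polar form with \<open>p\<close> would be the functional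
  \<open>a\<close> itself, so \<open>p\<close> would be orthogonal to the whole solid; the square
  root \<open>s\<close> makes \<open>p\<close> singular, against nonsingularity.\<close>

lemma elliptic_solid_imp_nth_0:
  fixes a :: "'a ^ 5"
  assumes "elliptic_solid (solid a)" "a \<noteq> 0"
  shows "a $ 0 \<noteq> 0"
proof
  assume 0: "a $ 0 = 0"
  obtain s where s: "s\<^sup>2 = a $ 1 * a $ 2 + a $ 3 * a $ 4" using ex_sqrt by blast
  define p where "p = vec5 s (a $ 2) (a $ 1) (a $ 4) (a $ 3)"
  have "p \<in> solid a" "qf p = 0"
    using 0 s by (simp_all add: mem_solid dot_def p_def qf_def add_ac mult_ac)
  moreover have "p \<noteq> 0" using assms(2) 0 by (auto simp: p_def vec5_eq_iff)
  ultimately obtain w where "w \<in> solid a" "polar p w \<noteq> 0"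
    using assms(1) unfolding elliptic_solid_def nonsingular_on_def by blast
  then show False using 0 by (simp add: mem_solid dot_def p_def polar_eq add_ac)
qed

lemma elliptic_solid_iff:
  fixes a :: "'a ^ 5"
  assumes a: "a $ 0 = 1"
  shows "elliptic_solid (solid a) \<longleftrightarrow> elliptic_covector a"
proof
  assume el: "elliptic_solid (solid a)"
  have "\<exists>c. y = vsmult c x"
    if xy: "x \<in> solid a" "y \<in> solid a" "qf x = 0" "qf y = 0" "polar x y = 0" "x \<noteq> 0" for x y
  proof (rule ccontr)
    assume nc: "\<nexists>c. y = vsmult c x"
    have "\<alpha> = 0 \<and> \<beta> = 0" if e: "vsmult \<alpha> x + vsmult \<beta> y = 0" for \<alpha> \<beta>
    proof -
      have "\<beta> = 0"
      proof (rule ccontr)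
        assume "\<beta> \<noteq> 0"
        have "vsmult \<beta> y = vsmult \<alpha> x" using e vec_add_eq_0_iff by metis
        then have "vsmult (inverse \<beta>) (vsmult \<beta> y) = vsmult (inverse \<beta>) (vsmult \<alpha> x)" by simp
        then have "y = vsmult (inverse \<beta> * \<alpha>) x" using \<open>\<beta> \<noteq> 0\<close> by simp
        then show False using nc by blast
      qed
      then show ?thesis using e xy(6) by (simp add: vsmult_eq_0_iff)
    qed
    moreover have "qf (vsmult \<alpha> x + vsmult \<beta> y) = 0" for \<alpha> \<beta>
      using xy by (simp add: qf_add qf_vsmult polar_bilinear)
    ultimately have "contains_line (solid a)"
      unfolding contains_line_def using xy(1,2) by blast
    then show False using el by (simp add: elliptic_solid_def)
  qed
  then show "elliptic_covector a" using a by (auto simp: elliptic_covector_def)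
next
  assume el: "elliptic_covector a"
  have "\<not> contains_line (solid a)"
  proof
    assume "contains_line (solid a)"
    then obtain x y where xy: "x \<in> solid a" "y \<in> solid a"
      and ind: "\<And>\<alpha> \<beta>. vsmult \<alpha> x + vsmult \<beta> y = 0 \<Longrightarrow> \<alpha> = 0 \<and> \<beta> = 0"
      and sing: "\<And>\<alpha> \<beta>. qf (vsmult \<alpha> x + vsmult \<beta> y) = 0"
      unfolding contains_line_def by blast
    have 1: "qf x = 0" "qf y = 0" "polar x y = 0"
      using sing[of 1 0] sing[of 0 1] sing[of 1 1] by (simp_all add: qf_add)
    have "x \<noteq> 0" using ind[of 1 0] by auto
    then obtain c where "y = vsmult c x"
      using el xy 1 unfolding elliptic_covector_def by blast
    then have "vsmult c x + vsmult 1 y = 0" by simp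
    then show False using ind by (metis zero_neq_one)
  qed
  moreover have "nonsingular_on (solid a)"
    using solid_polar_nondegenerate[OF a] by (auto simp: nonsingular_on_def)
  ultimately show "elliptic_solid (solid a)" by (simp add: elliptic_solid_def)
qed

text \<open>Scaling a covector does not change its solid, so a nonzero coordinate 0 can be made
  1.\<close>

lemma ell_ovoids_eq: "ell_ovoids = ovoid ` {a :: 'a ^ 5. elliptic_covector a}"
proof (rule set_eqI, rule iffI)
  fix X :: "('a ^ 5) set set" assume "X \<in> ell_ovoids"
  then obtain a where a: "X = ovoid a" "a \<noteq> 0" "elliptic_solid (solid a)"
    by (auto simp: ell_ovoids_def ovoid_def)
  define b where "b = vsmult (inverse (a $ 0)) a"
  have 0: "a $ 0 \<noteq> 0" using elliptic_solid_imp_nth_0 a by blast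
  then have "solid b = solid a" by (auto simp: b_def mem_solid dot_linear)
  moreover have "b $ 0 = 1" using 0 by (simp add: b_def)
  ultimately have "elliptic_covector b" "X = ovoid b"
    using a elliptic_solid_iff[of b] by (auto simp: ovoid_def)
  then show "X \<in> ovoid ` {a. elliptic_covector a}" by blast
next
  fix X :: "('a ^ 5) set set" assume "X \<in> ovoid ` {a. elliptic_covector a}"
  then obtain a where a: "X = ovoid a" "elliptic_covector a" by blast
  then have "a $ 0 = 1" by (simp add: elliptic_covector_def)
  then show "X \<in> ell_ovoids"
    using a elliptic_solid_iff unfolding ell_ovoids_def ovoid_def
    by (auto intro!: exI[of _ a])
qed

end

section \<open>Tangency and rosettes\<close>

text \<open>For distinct elliptic covectors this is adjacency of the ovoids, by
  \<open>adjacent_imp_tangent\<close> and \<open>tangent_imp_adjacent\<close>. It also holds for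
  \<open>a = b\<close>, so distinctness is always stated separately.\<close>

definition tangent :: "'a::field ^ 5 \<Rightarrow> 'a ^ 5 \<Rightarrow> bool" where
  "tangent a b \<longleftrightarrow> qf (tangent_pt a b) = 0"

text \<open>For distinct normalised \<open>a\<close> and \<open>b\<close>, these are the solids
  through their common plane except the one of \<open>a + b\<close>, which is the solid orthogonal
  to the base point.\<close>

definition line_pt :: "'a::field ^ 5 \<Rightarrow> 'a ^ 5 \<Rightarrow> 'a \<Rightarrow> 'a ^ 5" where
  "line_pt a b t = a + vsmult t (a + b)"

context char2_field
begin

lemma elliptic_covector_nth_0: "elliptic_covector a \<Longrightarrow> a $ 0 = (1::'a)"
  by (simp add: elliptic_covector_def)

lemma elliptic_covectorD:
  fixes a x y :: "'a ^ 5"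
  assumes "elliptic_covector a" "x \<in> solid a" "y \<in> solid a" "qf x = 0" "qf y = 0" "polar x y = 0" "x \<noteq> 0"
  obtains c where "y = vsmult c x"
  using assms unfolding elliptic_covector_def by blast

lemma solid_add: "x \<in> solid a \<Longrightarrow> y \<in> solid a \<Longrightarrow> x + y \<in> solid (a :: 'a ^ 5)"
  by (simp add: mem_solid dot_linear)

lemma solid_vsmult: "x \<in> solid a \<Longrightarrow> vsmult c x \<in> solid (a :: 'a ^ 5)"
  by (simp add: mem_solid dot_linear)

lemma tangent_commute: "tangent a b \<longleftrightarrow> tangent b (a :: 'a ^ 5)"
  by (simp add: tangent_def tangent_pt_commute)

lemma tangent_iff:
  fixes a b :: "'a ^ 5"
  assumes "a $ 0 = 1" "b $ 0 = 1"
  shows "tangent a b \<longleftrightarrow> qf a + qf b = polar a b + (polar a b)\<^sup>2"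
  using add_eq_0_iff_eq[of "polar a b + (polar a b)\<^sup>2" "qf a + qf b"]
  by (auto simp: tangent_def qf_tangent_pt[OF assms] add_ac)

lemma ppoint_vsmult: "c \<noteq> (0::'a) \<Longrightarrow> ppoint (vsmult c v) = ppoint v"
  by (auto simp: ppoint_eq_iff)

text \<open>A common point is orthogonal to the base point by \<open>polar_tangent_pt\<close>, hence
  proportional to it because \<open>a\<close> is elliptic.\<close>

lemma ovoid_inter_tangent:
  fixes a b :: "'a ^ 5"
  assumes a: "elliptic_covector a" and b: "b $ 0 = 1" and "a \<noteq> b" and t: "tangent a b"
  shows "ovoid a \<inter> ovoid b = {ppoint (tangent_pt a b)}"
proof -
  have a0: "a $ 0 = 1" using a by (rule elliptic_covector_nth_0)
  have nz: "tangent_pt a b \<noteq> 0" using tangent_pt_eq_0[OF a0 b] \<open>a \<noteq> b\<close> by blast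
  note S = tangent_pt_mem_solid[OF a0 b]
  have "P = ppoint (tangent_pt a b)" if P: "P \<in> ovoid a" "P \<in> ovoid b" for P
  proof -
    obtain v where v: "P = ppoint v" "v \<noteq> 0" "qf v = 0" "v \<in> solid a"
      using P(1) by (rule ovoid_cases)
    then have "v \<in> solid b" using P(2) by (simp add: ppoint_mem_ovoid)
    then have "polar (tangent_pt a b) v = 0"
      using v(4) by (simp add: polar_tangent_pt[OF a0 b] dot_linear mem_solid)
    then obtain c where "v = vsmult c (tangent_pt a b)"
      using elliptic_covectorD[OF a S(1) v(4) _ v(3)] t nz unfolding tangent_def by blast
    moreover from this have "c \<noteq> 0" using v(2) by auto
    ultimately show ?thesis using v(1) ppoint_vsmult by simp
  qed
  moreover have "ppoint (tangent_pt a b) \<in> ovoid a \<inter> ovoid b"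
    using S nz t by (simp add: ppoint_mem_ovoid tangent_def)
  ultimately show ?thesis by blast
qed

text \<open>On \<open>w + vsmult t v\<close> the form is affine in \<open>t\<close> with slope
  \<open>polar v w\<close>, so it has a zero; this yields a singular point other than that of
  \<open>v\<close>.\<close>

lemma second_singular_vector:
  fixes v w :: "'a ^ 5"
  assumes "qf v = 0" "polar v w \<noteq> 0"
  obtains t where "qf (w + vsmult t v) = 0" "polar v (w + vsmult t v) \<noteq> 0"
proof
  let ?t = "qf w / polar v w"
  show "qf (w + vsmult ?t v) = 0" "polar v (w + vsmult ?t v) \<noteq> 0"
    using assms by (simp_all add: qf_add qf_vsmult polar_bilinear polar_commute[of w v])
qed

lemma ppoint_neq_if_polar: "polar v u \<noteq> (0::'a) \<Longrightarrow> ppoint u \<noteq> ppoint v"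
  by (auto simp: ppoint_eq_iff polar_bilinear)

text \<open>Test \<open>v\<close> against the vectors whose last four coordinates are d_j e_i + d_i e_j,
  where d = a + b.\<close>

lemma plane_radical:
  fixes a b v :: "'a ^ 5"
  assumes a: "a $ 0 = 1" and b: "b $ 0 = 1" and "a \<noteq> b"
    and v: "v \<in> solid a" "v \<in> solid b"
    and rad: "\<And>w. w \<in> solid a \<Longrightarrow> w \<in> solid b \<Longrightarrow> polar v w = 0"
  shows "\<exists>c. v = vsmult c (tangent_pt a b)"
proof -
  define d1 d2 d3 d4 where d: "d1 = a $ 1 + b $ 1" "d2 = a $ 2 + b $ 2" "d3 = a $ 3 + b $ 3" "d4 = a $ 4 + b $ 4"
  have b': "b $ 1 = a $ 1 + d1" "b $ 2 = a $ 2 + d2" "b $ 3 = a $ 3 + d3" "b $ 4 = a $ 4 + d4"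
    by (simp_all add: d)
  have lift: "vec5 (a $ 1 * w1 + a $ 2 * w2 + a $ 3 * w3 + a $ 4 * w4) w1 w2 w3 w4 \<in> solid a"
    "vec5 (a $ 1 * w1 + a $ 2 * w2 + a $ 3 * w3 + a $ 4 * w4) w1 w2 w3 w4 \<in> solid b"
    if "d1 * w1 + d2 * w2 + d3 * w3 + d4 * w4 = 0" for w1 w2 w3 w4
  proof -
    show "vec5 (a $ 1 * w1 + a $ 2 * w2 + a $ 3 * w3 + a $ 4 * w4) w1 w2 w3 w4 \<in> solid a"
      using a by (simp add: mem_solid dot_def add_ac)
    have "dot b (vec5 (a $ 1 * w1 + a $ 2 * w2 + a $ 3 * w3 + a $ 4 * w4) w1 w2 w3 w4)
        = d1 * w1 + d2 * w2 + d3 * w3 + d4 * w4"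
      using b by (simp add: dot_def b' char2_simps)
    then show "vec5 (a $ 1 * w1 + a $ 2 * w2 + a $ 3 * w3 + a $ 4 * w4) w1 w2 w3 w4 \<in> solid b"
      using that by (simp add: mem_solid)
  qed
  have R: "v $ 1 * w2 + v $ 2 * w1 + v $ 3 * w4 + v $ 4 * w3 = 0"
    if "d1 * w1 + d2 * w2 + d3 * w3 + d4 * w4 = 0" for w1 w2 w3 w4
    using rad[OF lift[OF that]] by (simp add: polar_eq)
  \<comment> \<open>These are the six 2 by 2 minors of (v2, v1, v4, v3) against (d1, d2, d3, d4);
    their vanishing makes the two rows proportional.\<close>
  have E: "v $ 2 * d2 = v $ 1 * d1" "v $ 2 * d3 = v $ 4 * d1" "v $ 2 * d4 = v $ 3 * d1"
    "v $ 1 * d3 = v $ 4 * d2" "v $ 1 * d4 = v $ 3 * d2" "v $ 4 * d4 = v $ 3 * d3"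
    using R[of d2 d1 0 0] R[of d3 0 d1 0] R[of d4 0 0 d1] R[of 0 d3 d2 0] R[of 0 d4 0 d2] R[of 0 0 d4 d3]
    by (simp_all add: add_eq_0_iff_eq mult.commute)
  have "d1 \<noteq> 0 \<or> d2 \<noteq> 0 \<or> d3 \<noteq> 0 \<or> d4 \<noteq> 0"
    using \<open>a \<noteq> b\<close> a b by (auto simp: vec5_eq_iff d add_eq_0_iff_eq)
  then have "\<exists>c. v $ 1 = c * d2 \<and> v $ 2 = c * d1 \<and> v $ 3 = c * d4 \<and> v $ 4 = c * d3"
  proof (elim disjE)
    assume "d1 \<noteq> 0"
    then show ?thesis using E by (intro exI[of _ "v $ 2 / d1"]) (simp add: field_simps)
  next
    assume "d2 \<noteq> 0"
    then show ?thesis using E by (intro exI[of _ "v $ 1 / d2"]) (simp add: field_simps)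
  next
    assume "d3 \<noteq> 0"
    then show ?thesis using E by (intro exI[of _ "v $ 4 / d3"]) (simp add: field_simps)
  next
    assume "d4 \<noteq> 0"
    then show ?thesis using E by (intro exI[of _ "v $ 3 / d4"]) (simp add: field_simps)
  qed
  then obtain c where c: "v $ 1 = c * d2" "v $ 2 = c * d1" "v $ 3 = c * d4" "v $ 4 = c * d3" by blast
  have "v $ 0 = a $ 1 * v $ 1 + a $ 2 * v $ 2 + a $ 3 * v $ 3 + a $ 4 * v $ 4"
    using v(1) a
      add_eq_0_iff_eq[of "v $ 0" "a $ 1 * v $ 1 + a $ 2 * v $ 2 + a $ 3 * v $ 3 + a $ 4 * v $ 4"]
    by (simp add: mem_solid dot_def add_ac)
  also have "\<dots> = c * polar a b"
    by (simp add: c polar_eq b' char2_simps)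
  finally show ?thesis
    using c by (intro exI[of _ c]) (simp add: vec5_eq_iff tangent_pt_def d)
qed

text \<open>If the radical of the common plane is not singular, the single common point
  \<open>v\<close> is not in the radical. Some \<open>w\<close> of the plane is then not orthogonal
  to \<open>v\<close>, and the line through both carries a second common point.\<close>

lemma adjacent_imp_tangent:
  fixes a b :: "'a ^ 5"
  assumes a: "elliptic_covector a" and b: "elliptic_covector b" and adj: "adjacent (ovoid a) (ovoid b)"
  shows "tangent a b"
proof (rule ccontr)
  assume nt: "\<not> tangent a b"
  have a0: "a $ 0 = 1" and b0: "b $ 0 = 1" using a b by (simp_all add: elliptic_covector_nth_0)
  have "a \<noteq> b" using adj by (auto simp: adjacent_def)
  obtain P where P: "ovoid a \<inter> ovoid b = {P}"
    using adj unfolding adjacent_def by (metis card_1_singletonE)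
  then have "P \<in> ovoid a" by blast
  then obtain v where v: "P = ppoint v" "v \<noteq> 0" "qf v = 0" "v \<in> solid a" by (rule ovoid_cases)
  have vb: "v \<in> solid b" using P v(1) ppoint_mem_ovoid by blast
  obtain w where w: "w \<in> solid a" "w \<in> solid b" "polar v w \<noteq> 0"
  proof (rule ccontr)
    assume "\<not> thesis"
    then have "\<And>w. w \<in> solid a \<Longrightarrow> w \<in> solid b \<Longrightarrow> polar v w = 0" using that by blast
    then obtain c where "v = vsmult c (tangent_pt a b)"
      using plane_radical[OF a0 b0 \<open>a \<noteq> b\<close> v(4) vb] by blast
    then show False using v(2,3) nt by (auto simp: qf_vsmult tangent_def)
  qed
  obtain t where t: "qf (w + vsmult t v) = 0" "polar v (w + vsmult t v) \<noteq> 0"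
    using second_singular_vector[OF v(3) w(3)] .
  have "ppoint (w + vsmult t v) \<in> ovoid a \<inter> ovoid b"
    using t w v(4) vb by (auto simp: ppoint_mem_ovoid solid_add solid_vsmult)
  then show False using P v(1) ppoint_neq_if_polar[OF t(2)] by blast
qed

text \<open>The ovoids differ because \<open>ovoid a\<close> has a point besides the base point,
  which is their only common point.\<close>

lemma tangent_imp_adjacent:
  fixes a b :: "'a ^ 5"
  assumes a: "elliptic_covector a" and b: "elliptic_covector b" and "a \<noteq> b" and t: "tangent a b"
  shows "ovoid a \<noteq> ovoid b" "adjacent (ovoid a) (ovoid b)"
proof -
  let ?p = "tangent_pt a b"
  have a0: "a $ 0 = 1" and b0: "b $ 0 = 1" using a b by (simp_all add: elliptic_covector_nth_0)
  have I: "ovoid a \<inter> ovoid b = {ppoint ?p}" using ovoid_inter_tangent[OF a b0 \<open>a \<noteq> b\<close> t] .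
  have S: "?p \<in> solid a" "?p \<noteq> 0"
    using tangent_pt_mem_solid[OF a0 b0] tangent_pt_eq_0[OF a0 b0] \<open>a \<noteq> b\<close> by auto
  obtain w where w: "w \<in> solid a" "polar ?p w \<noteq> 0"
    using solid_polar_nondegenerate[OF a0 S] by blast
  obtain s where s: "qf (w + vsmult s ?p) = 0" "polar ?p (w + vsmult s ?p) \<noteq> 0"
    using second_singular_vector[OF t[unfolded tangent_def] w(2)] .
  have "ppoint (w + vsmult s ?p) \<in> ovoid a"
    using s w S by (auto simp: ppoint_mem_ovoid solid_add solid_vsmult)
  then show ne: "ovoid a \<noteq> ovoid b" using I ppoint_neq_if_polar[OF s(2)] by blast
  show "adjacent (ovoid a) (ovoid b)"
    using ne I a b by (simp add: adjacent_def ell_ovoids_eq)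
qed

text \<open>The reflection in \<open>r\<close> below is an isometry that maps the second solid to the first.\<close>

lemma elliptic_covector_tangent:
  fixes a b :: "'a ^ 5"
  assumes a: "elliptic_covector a" and b0: "b $ 0 = 1" and t: "tangent a b"
  shows "elliptic_covector b"
proof -
  have a0: "a $ 0 = 1" using a by (rule elliptic_covector_nth_0)
  \<comment> \<open>The base point is singular; adding the nucleus gives \<open>qf r = 1\<close> and
    leaves the polar form with it unchanged.\<close>
  define r where "r = tangent_pt a b + vec5 1 0 0 0 0"
  define \<phi> where "\<phi> x = x + vsmult (polar x r) r" for x
  have "qf r = 1"
    using t by (simp add: r_def qf_add tangent_def polar_eq) (simp add: qf_def)
  then have qf\<phi>: "qf (\<phi> x) = qf x" for x
    by (simp add: \<phi>_def qf_add qf_vsmult polar_bilinear power2_eq_square)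
  have polar\<phi>: "polar (\<phi> x) (\<phi> y) = polar x y" for x y
    by (simp add: \<phi>_def polar_bilinear polar_commute[of r] char2_simps)
  have \<phi>\<phi>: "\<phi> (\<phi> x) = x" for x
    by (simp add: \<phi>_def polar_bilinear add.assoc)
  have \<phi>0: "\<phi> x = 0 \<Longrightarrow> x = 0" for x
    using \<phi>\<phi>[of x] by (auto simp: \<phi>_def vec5_eq_iff polar_eq)
  have \<phi>c: "\<phi> (vsmult c x) = vsmult c (\<phi> x)" for c x
    by (simp add: \<phi>_def polar_bilinear vec_eq_iff distrib_left mult.assoc)
  have dr: "dot a r = 1"
    using a0 tangent_pt_mem_solid(1)[OF a0 b0] by (simp add: r_def dot_linear mem_solid) (simp add: dot_def)
  \<comment> \<open>On the second solid \<open>polar x r\<close> equals \<open>dot a x\<close>, and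
    \<open>dot a r = 1\<close>, so the added multiple of \<open>r\<close> cancels
    \<open>dot a x\<close>.\<close>
  have \<phi>S: "\<phi> x \<in> solid a" if "x \<in> solid b" for x
  proof -
    have "polar x r = polar (tangent_pt a b) x"
      by (simp add: r_def polar_bilinear polar_commute[of x]) (simp add: polar_eq)
    also have "\<dots> = dot a x"
      using that by (simp add: polar_tangent_pt[OF a0 b0] dot_linear mem_solid)
    finally show ?thesis by (simp add: mem_solid \<phi>_def dot_linear dr)
  qed
  have "\<exists>c. y = vsmult c x"
    if xy: "x \<in> solid b" "y \<in> solid b" "qf x = 0" "qf y = 0" "polar x y = 0" "x \<noteq> 0" for x y
  proof -
    obtain c where "\<phi> y = vsmult c (\<phi> x)"
      using elliptic_covectorD[OF a \<phi>S[OF xy(1)] \<phi>S[OF xy(2)]] xy \<phi>0 by (auto simp: qf\<phi> polar\<phi>)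
    then have "\<phi> (\<phi> y) = \<phi> (\<phi> (vsmult c x))" by (simp add: \<phi>c)
    then show ?thesis by (auto simp: \<phi>\<phi>)
  qed
  then show ?thesis using b0 by (auto simp: elliptic_covector_def)
qed

text \<open>Two points of the line differ by \<open>t + s\<close> times \<open>a + b\<close>, and
  their polar form scales by the same factor; so all pairs on the line share one base point.\<close>

lemma tangent_pt_line_pt:
  fixes a b :: "'a ^ 5"
  shows "tangent_pt (line_pt a b t) (line_pt a b s) = vsmult (t + s) (tangent_pt a b)"
proof -
  have "polar (line_pt a b t) (line_pt a b s) = (t + s) * polar a b"
    by (simp add: line_pt_def polar_bilinear polar_commute[of b a] char2_simps)
  then show ?thesis
    by (simp add: vec5_eq_iff tangent_pt_def) (simp add: line_pt_def char2_simps)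
qed

lemma line_pt_0 [simp]: "line_pt a b 0 = (a :: 'a ^ 5)"
  by (simp add: line_pt_def)

lemma line_pt_1 [simp]: "line_pt a b 1 = (b :: 'a ^ 5)"
  by (simp add: line_pt_def)

lemma line_pt_nth_0: "a $ 0 = 1 \<Longrightarrow> b $ 0 = 1 \<Longrightarrow> line_pt a b t $ 0 = (1::'a)"
  by (simp add: line_pt_def)

text \<open>Each member is tangent to \<open>a\<close>, hence elliptic; distinct parameters give
  distinct ovoids with the same base point, which makes q of them.\<close>

lemma rosette_line:
  fixes a b :: "'a ^ 5"
  assumes a: "elliptic_covector a" and b0: "b $ 0 = 1" and "a \<noteq> b" and t: "tangent a b"
  shows "rosette (ppoint (tangent_pt a b)) (ovoid ` range (line_pt a b))"
proof -
  let ?p = "tangent_pt a b" and ?l = "line_pt a b"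
  have a0: "a $ 0 = 1" using a by (rule elliptic_covector_nth_0)
  have l0: "?l s $ 0 = 1" for s using a0 b0 by (rule line_pt_nth_0)
  have p: "?p \<noteq> 0" using tangent_pt_eq_0[OF a0 b0] \<open>a \<noteq> b\<close> by blast
  have tl: "tangent (?l s) (?l u)" for s u
    using t by (simp add: tangent_def tangent_pt_line_pt qf_vsmult)
  have el: "elliptic_covector (?l s)" for s
    using elliptic_covector_tangent[OF a l0] tl[of 0 s] by simp
  have ne: "?l s \<noteq> ?l u" if "s \<noteq> u" for s u
  proof
    assume e: "?l s = ?l u"
    have "tangent_pt (?l u) (?l u) = 0" by (simp add: tangent_pt_line_pt)
    then have "vsmult (s + u) ?p = 0" using e tangent_pt_line_pt by metis
    then show False using p that by (simp add: vsmult_eq_0_iff add_eq_0_iff_eq)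
  qed
  have "inj (\<lambda>s. ovoid (?l s))"
    by (rule injI) (use tangent_imp_adjacent(1)[OF el el ne tl] in blast)
  then have "card (ovoid ` range ?l) = CARD('a)"
    by (simp add: image_image card_image)
  moreover have "ovoid (?l s) \<inter> ovoid (?l u) = {ppoint ?p}" if "ovoid (?l s) \<noteq> ovoid (?l u)" for s u
  proof -
    have "s \<noteq> u" using that by auto
    then have "ovoid (?l s) \<inter> ovoid (?l u) = {ppoint (vsmult (s + u) ?p)}"
      using ovoid_inter_tangent[OF el l0 ne tl] by (simp add: tangent_pt_line_pt)
    then show ?thesis using \<open>s \<noteq> u\<close> by (simp add: ppoint_vsmult add_eq_0_iff_eq)
  qed
  moreover have "ppoint ?p \<in> Q0" using p t by (auto simp: Q0_def tangent_def)
  ultimately show ?thesis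
    using el unfolding rosette_def ell_ovoids_eq by auto
qed

end

section \<open>Cliques\<close>

definition tangent_family :: "('a::field ^ 5) set \<Rightarrow> bool" where
  "tangent_family A \<longleftrightarrow> (\<forall>a\<in>A. elliptic_covector a) \<and> (\<forall>a\<in>A. \<forall>b\<in>A. a \<noteq> b \<longrightarrow> tangent a b)"

definition triple :: "'a::field ^ 5 \<Rightarrow> 'a ^ 5 \<Rightarrow> 'a ^ 5 \<Rightarrow> 'a" where
  "triple a b c = polar a b + polar a c + polar b c"

text \<open>Within a tangent family the condition on triples says that no three members lie on a
  common affine line.\<close>

definition general_family :: "('a::field ^ 5) set \<Rightarrow> bool" where
  "general_family A \<longleftrightarrow> tangent_family A \<and>
     (\<forall>a\<in>A. \<forall>b\<in>A. \<forall>c\<in>A. distinct [a, b, c] \<longrightarrow> triple a b c = 1)"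

context char2_field
begin

lemma triple_cases:
  fixes a b c :: "'a ^ 5"
  assumes 0: "a $ 0 = 1" "b $ 0 = 1" "c $ 0 = 1" and t: "tangent a b" "tangent a c" "tangent b c"
  shows "triple a b c = 0 \<or> triple a b c = 1"
proof -
  have h: "qf a + qf b = polar a b + (polar a b)\<^sup>2" "qf a + qf c = polar a c + (polar a c)\<^sup>2"
    "qf b + qf c = polar b c + (polar b c)\<^sup>2"
    using t tangent_iff 0 by blast+
  have "triple a b c + (triple a b c)\<^sup>2
      = (polar a b + (polar a b)\<^sup>2) + (polar a c + (polar a c)\<^sup>2) + (polar b c + (polar b c)\<^sup>2)"
    by (simp add: triple_def char2_simps)
  \<comment> \<open>Each of \<open>qf a\<close>, \<open>qf b\<close>, \<open>qf c\<close> occurs in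
    two of the three equations and cancels.\<close>
  also have "\<dots> = 0"
    unfolding h[symmetric] by (simp add: add_ac)
  finally have "triple a b c * (1 + triple a b c) = 0"
    by (simp add: distrib_left power2_eq_square)
  then show ?thesis by (auto simp: add_eq_0_iff_eq)
qed

text \<open>The two base points are orthogonal singular vectors of an elliptic solid, hence
  proportional; the factor is the parameter of \<open>c\<close> on the line.\<close>

lemma line_pt_if_triple_eq_0:
  fixes a b c :: "'a ^ 5"
  assumes a: "elliptic_covector a" and 0: "b $ 0 = 1" "c $ 0 = 1" and "a \<noteq> b"
    and t: "tangent a b" "tangent a c" and s: "triple a b c = 0"
  obtains r where "c = line_pt a b r"
proof -
  have a0: "a $ 0 = 1" using a by (rule elliptic_covector_nth_0)
  have "polar (tangent_pt a b) (tangent_pt a c) = 0"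
    using s by (simp add: triple_def polar_tangent_pt_tangent_pt)
  then obtain r where r: "tangent_pt a c = vsmult r (tangent_pt a b)"
    using elliptic_covectorD[OF a tangent_pt_mem_solid(1)[OF a0 0(1)] tangent_pt_mem_solid(1)[OF a0 0(2)]]
      t tangent_pt_eq_0[OF a0 0(1)] \<open>a \<noteq> b\<close> unfolding tangent_def by blast
  have e: "a $ i + c $ i = r * (a $ i + b $ i)" if "i \<in> {1, 2, 3, 4}" for i
    using r that by (auto simp: vec5_eq_iff tangent_pt_def)
  have "c $ i = line_pt a b r $ i" if "i \<in> {1, 2, 3, 4}" for i
  proof -
    have "c $ i = a $ i + (a $ i + c $ i)" by simp
    also have "\<dots> = line_pt a b r $ i"
      unfolding e[OF that] by (simp add: line_pt_def)
    finally show ?thesis .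
  qed
  then have "c = line_pt a b r"
    using a0 0 line_pt_nth_0[of a b r] by (simp add: vec5_eq_iff)
  then show ?thesis by (rule that)
qed

lemma tangent_family_clique:
  fixes A :: "('a ^ 5) set"
  assumes "tangent_family A"
  shows "clique (ovoid ` A)" "inj_on ovoid A"
proof -
  have el: "elliptic_covector a" if "a \<in> A" for a
    using assms that by (simp add: tangent_family_def)
  have t: "tangent a b" if "a \<in> A" "b \<in> A" "a \<noteq> b" for a b
    using assms that by (simp add: tangent_family_def)
  show "clique (ovoid ` A)"
    unfolding clique_def ell_ovoids_eq
  proof (intro conjI ballI impI)
    show "ovoid ` A \<subseteq> ovoid ` {a. elliptic_covector a}" using el by blast
  next
    fix X Y assume "X \<in> ovoid ` A" "Y \<in> ovoid ` A" and "X \<noteq> Y"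
    then obtain a b where ab: "a \<in> A" "b \<in> A" "X = ovoid a" "Y = ovoid b" by blast
    then have "a \<noteq> b" using \<open>X \<noteq> Y\<close> by blast
    then show "adjacent X Y" using tangent_imp_adjacent(2)[OF el el _ t] ab by simp
  qed
  show "inj_on ovoid A"
    using tangent_imp_adjacent(1)[OF el el _ t] by (meson inj_onI)
qed

lemma clique_tangent_family:
  fixes C :: "('a ^ 5) set set set"
  assumes "clique C"
  obtains A where "tangent_family A" "C = ovoid ` A" "card A = card C"
proof -
  have "C \<subseteq> ovoid ` {a. elliptic_covector a}"
    using assms by (simp add: clique_def ell_ovoids_eq)
  then obtain A where A: "A \<subseteq> {a. elliptic_covector a}" "inj_on ovoid A" "C = ovoid ` A"
    by (auto simp: subset_image_inj)
  have "tangent a b" if "a \<in> A" "b \<in> A" "a \<noteq> b" for a b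
  proof (rule adjacent_imp_tangent)
    show "elliptic_covector a" "elliptic_covector b" using A that by auto
    have "ovoid a \<noteq> ovoid b" using A that by (auto simp: inj_on_def)
    then show "adjacent (ovoid a) (ovoid b)"
      using assms A that by (auto simp: clique_def)
  qed
  then have "tangent_family A" using A by (auto simp: tangent_family_def)
  then show ?thesis using that A by (simp add: card_image)
qed

text \<open>One triple of value 0 forces the whole family onto a line: \<open>c\<close> has a
  parameter \<open>r\<close> other than 0 and 1, and for any further \<open>e\<close> the values
  \<open>triple a c e\<close> and \<open>triple a b e\<close> lie in {0, 1} and have ratio
  \<open>r\<close>, so both vanish.\<close>

lemma nonlinear_imp_general:
  fixes A :: "('a ^ 5) set"
  assumes A: "tangent_family A" and nl: "nonlinear_clique (ovoid ` A)"
  shows "general_family A"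
proof -
  have el: "elliptic_covector x" and n0: "x $ 0 = 1" if "x \<in> A" for x
    using A that by (auto simp: tangent_family_def elliptic_covector_nth_0)
  have t: "tangent x y" if "x \<in> A" "y \<in> A" "x \<noteq> y" for x y
    using A that by (auto simp: tangent_family_def)
  have "triple a b c = 1" if abc: "a \<in> A" "b \<in> A" "c \<in> A" "distinct [a, b, c]" for a b c
  proof (rule ccontr)
    assume "triple a b c \<noteq> 1"
    then have "triple a b c = 0"
      using triple_cases[OF n0 n0 n0 t t t] abc by auto
    then obtain r where r: "c = line_pt a b r"
      using line_pt_if_triple_eq_0[OF el n0 n0 _ t t, of a b c] abc by auto
    then have r01: "r \<noteq> 0" "r \<noteq> 1" using abc by auto
    have "tangent_pt a c = vsmult r (tangent_pt a b)"
      using tangent_pt_line_pt[of a b 0 r] r by simp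
    then have r_triple: "triple a c e = r * triple a b e" for e
      by (metis polar_bilinear(3) polar_tangent_pt_tangent_pt triple_def)
    have "e \<in> range (line_pt a b)" if "e \<in> A" for e
    proof -
      consider "e = line_pt a b 0" | "e = line_pt a b 1" | "e = c" | "distinct [a, b, c, e]"
        using abc by auto
      then show ?thesis
      proof cases
        case 4
        then have "triple a b e = 0 \<or> triple a b e = 1" "triple a c e = 0 \<or> triple a c e = 1"
          using triple_cases[OF n0 n0 n0 t t t, of a b e] triple_cases[OF n0 n0 n0 t t t, of a c e]
            abc that by auto
        then have "triple a b e = 0" using r_triple r01 by auto
        then show ?thesis
          using line_pt_if_triple_eq_0[OF el n0 n0 _ t t, of a b e] abc that 4 by auto
      qed (use r rangeI[of "line_pt a b" 0] rangeI[of "line_pt a b" 1] in auto)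
    qed
    then have "ovoid ` A \<subseteq> ovoid ` range (line_pt a b)" by blast
    moreover have "rosette (ppoint (tangent_pt a b)) (ovoid ` range (line_pt a b))"
      using rosette_line[OF el n0 _ t] abc by auto
    ultimately show False using nl unfolding nonlinear_clique_def by blast
  qed
  then show ?thesis using A by (auto simp: general_family_def)
qed

text \<open>In a rosette the base points of \<open>a\<close>, \<open>b\<close> and of
  \<open>a\<close>, \<open>c\<close> coincide, so their inner product \<open>triple a b c\<close>
  would be 0.\<close>

lemma nonlinear_clique_if_triple:
  fixes A :: "('a ^ 5) set"
  assumes A: "tangent_family A" and abc: "a \<in> A" "b \<in> A" "c \<in> A" and s: "triple a b c \<noteq> 0"
  shows "nonlinear_clique (ovoid ` A)"
proof -
  have ne: "a \<noteq> b" "a \<noteq> c" using s by (auto simp: triple_def polar_commute)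
  have el: "elliptic_covector x" and n0: "x $ 0 = 1" if "x \<in> A" for x
    using A that by (auto simp: tangent_family_def elliptic_covector_nth_0)
  have t: "tangent x y" if "x \<in> A" "y \<in> A" "x \<noteq> y" for x y
    using A that by (auto simp: tangent_family_def)
  have False if R: "rosette p R" "ovoid ` A \<subseteq> R" for p R
  proof -
    have "ovoid a \<noteq> ovoid b" "ovoid a \<noteq> ovoid c"
      using tangent_family_clique(2)[OF A] abc ne by (auto simp: inj_on_def)
    then have "ovoid a \<inter> ovoid b = {p}" "ovoid a \<inter> ovoid c = {p}"
      using R abc unfolding rosette_def by blast+
    then have "ppoint (tangent_pt a b) = ppoint (tangent_pt a c)"
      using ovoid_inter_tangent[OF el n0 _ t] abc ne by auto
    then show False
      using ppoint_neq_if_polar[of "tangent_pt a c" "tangent_pt a b"] s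
      by (simp add: polar_tangent_pt_tangent_pt triple_def polar_commute[of c b] add_ac)
  qed
  then show ?thesis
    using tangent_family_clique(1)[OF A] by (auto simp: nonlinear_clique_def)
qed

section \<open>Base points seen from a fixed member of a general family\<close>

lemma general_family_vectors:
  fixes A :: "('a ^ 5) set"
  assumes A: "general_family A" and a: "a \<in> A"
  shows "elliptic_covector a"
    and "x \<in> A \<Longrightarrow> tangent_pt a x \<in> solid a"
    and "x \<in> A \<Longrightarrow> x \<noteq> a \<Longrightarrow> qf (tangent_pt a x) = 0"
    and "x \<in> A \<Longrightarrow> y \<in> A \<Longrightarrow> distinct [a, x, y] \<Longrightarrow> polar (tangent_pt a x) (tangent_pt a y) = 1"
proof -
  have el: "elliptic_covector x" if "x \<in> A" for x
    using A that by (auto simp: general_family_def tangent_family_def)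
  show "elliptic_covector a" using el a .
  show "x \<in> A \<Longrightarrow> tangent_pt a x \<in> solid a"
    using tangent_pt_mem_solid(1) elliptic_covector_nth_0 el a by blast
  show "x \<in> A \<Longrightarrow> x \<noteq> a \<Longrightarrow> qf (tangent_pt a x) = 0"
    using A a by (auto simp: general_family_def tangent_family_def tangent_def)
  show "x \<in> A \<Longrightarrow> y \<in> A \<Longrightarrow> distinct [a, x, y] \<Longrightarrow> polar (tangent_pt a x) (tangent_pt a y) = 1"
    using A a unfolding general_family_def triple_def polar_tangent_pt_tangent_pt by blast
qed

lemma general_5_no_cube_root:
  fixes A :: "('a ^ 5) set"
  assumes A: "general_family A" and mem: "a \<in> A" "b \<in> A" "c \<in> A" "d \<in> A" "e \<in> A"
    and dist: "distinct [a, b, c, d, e]"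
  shows "w * w \<noteq> w + (1::'a)"
proof
  assume w: "w * w = w + 1"
  note v = general_family_vectors[OF A mem(1)]
  define B C D E where BCDE: "B = tangent_pt a b" "C = tangent_pt a c" "D = tangent_pt a d" "E = tangent_pt a e"
  have S: "B \<in> solid a" "C \<in> solid a" "D \<in> solid a" "E \<in> solid a"
    using v(2) mem by (auto simp: BCDE)
  have q: "qf B = 0" "qf C = 0" "qf D = 0" "qf E = 0"
    using v(3) mem dist by (auto simp: BCDE)
  have p: "polar B C = 1" "polar B D = 1" "polar B E = 1" "polar C D = 1" "polar C E = 1" "polar D E = 1"
    "polar C B = 1" "polar D B = 1" "polar E B = 1" "polar D C = 1" "polar E C = 1" "polar E D = 1"
    using v(4) mem dist by (auto simp: BCDE)
  \<comment> \<open>Here \<open>w + 1\<close> is w^2. On three of the vectors \<open>qf\<close> is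
    xy + xz + yz, which vanishes at (1, w, w^2) and (1, w^2, w) because 1 + w + w^2 = 0.\<close>
  define U V where UV: "U = B + vsmult w C + vsmult (w + 1) D" "V = C + vsmult (w + 1) D + vsmult w E"
  note expand = UV qf_add qf_vsmult polar_bilinear p q char2_simps w
  have "qf U = 0" "qf V = 0" "polar U V = 0" by (simp_all add: expand)
  moreover have UB: "polar U B = 1" by (simp add: expand)
  then have "U \<noteq> 0" by auto
  moreover have "U \<in> solid a" "V \<in> solid a" using S by (simp_all add: UV solid_add solid_vsmult)
  ultimately obtain k where "V = vsmult k U"
    using elliptic_covectorD[OF v(1)] by blast
  \<comment> \<open>Pairing with \<open>E\<close> shows that \<open>V\<close> is not a multiple of
    \<open>U\<close>: the value is 0 on \<open>U\<close> but the nonzero \<open>w\<close> on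
    \<open>V\<close>.\<close>
  then have "polar V E = k * polar U E" by (simp add: polar_bilinear)
  moreover have "polar V E = w" "polar U E = 0" by (simp_all add: expand)
  ultimately show False using w by auto
qed

lemma general_6_eq_sum:
  fixes A :: "('a ^ 5) set"
  assumes A: "general_family A" and mem: "a \<in> A" "b \<in> A" "c \<in> A" "d \<in> A" "e \<in> A" "f \<in> A"
    and dist: "distinct [a, b, c, d, e, f]"
  shows "f = a + b + c + d + e"
proof -
  note v = general_family_vectors[OF A mem(1)]
  have n0: "x $ 0 = 1" if "x \<in> A" for x
    using A that by (auto simp: general_family_def tangent_family_def elliptic_covector_nth_0)
  define B C D E F where B: "B = tangent_pt a b" "C = tangent_pt a c" "D = tangent_pt a d"
    "E = tangent_pt a e" "F = tangent_pt a f"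
  have S: "B \<in> solid a" "C \<in> solid a" "D \<in> solid a" "E \<in> solid a" "F \<in> solid a"
    using v(2) mem by (auto simp: B)
  have q: "qf B = 0" "qf C = 0" "qf D = 0" "qf E = 0" "qf F = 0"
    using v(3) mem dist by (auto simp: B)
  have p: "polar B C = 1" "polar B D = 1" "polar B E = 1" "polar B F = 1" "polar C D = 1"
    "polar C E = 1" "polar C F = 1" "polar D E = 1" "polar D F = 1" "polar E F = 1" "polar C B = 1"
    using v(4) mem dist by (auto simp: B)
  \<comment> \<open>\<open>qf U\<close> counts the ten pairs of summands, and pairing
    \<open>U\<close> with a summand counts the other four; both numbers are even.\<close>
  define U where U: "U = B + C + D + E + F"
  have "qf U = 0" by (simp add: U qf_add polar_bilinear p q)
  moreover have "polar B U = 0" by (simp add: U polar_bilinear p)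
  moreover have "B \<noteq> 0" using p(1) by auto
  moreover have "U \<in> solid a" using S by (simp add: U solid_add)
  ultimately obtain k where k: "U = vsmult k B"
    using elliptic_covectorD[OF v(1) S(1)] q(1) by blast
  have "polar U C = 0" by (simp add: U polar_bilinear p polar_commute[of _ C])
  then have "k = 0" using k p(1) by (simp add: polar_bilinear)
  then have U0: "U = 0" using k by simp
  \<comment> \<open>The relation adds up the differences of \<open>a\<close> from the five others;
    \<open>a\<close> occurs five times, so one copy survives.\<close>
  have "f $ i = (a + b + c + d + e) $ i" if "i \<in> {1, 2, 3, 4}" for i
  proof -
    have "f $ i + (a + b + c + d + e) $ i = 0"
      using U0 that by (auto simp: U B tangent_pt_def vec5_eq_iff add_ac)
    then show ?thesis by (simp only: add_eq_0_iff_eq)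
  qed
  then show ?thesis using n0 mem by (simp add: vec5_eq_iff)
qed

text \<open>Tangency and the triples express all values of \<open>qf\<close> and
  \<open>polar\<close> on the five members through \<open>qf a\<close> and the four values
  \<open>polar a x\<close>; tangency of \<open>a\<close> and \<open>f\<close> becomes a polynomial
  identity.\<close>

lemma sixth_tangent:
  fixes A :: "('a ^ 5) set"
  assumes A: "general_family A" and mem: "a \<in> A" "b \<in> A" "c \<in> A" "d \<in> A" "e \<in> A"
    and dist: "distinct [a, b, c, d, e]" and f: "f = a + b + c + d + e"
  shows "tangent a f" "f \<noteq> a"
proof -
  have n0: "x $ 0 = 1" if "x \<in> A" for x
    using A that by (auto simp: general_family_def tangent_family_def elliptic_covector_nth_0)
  have t: "qf x = qf a + polar a x + (polar a x)\<^sup>2" if "x \<in> A" "x \<noteq> a" for x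
  proof -
    have "qf a + qf x = polar a x + (polar a x)\<^sup>2"
      using A mem that n0 tangent_iff by (auto simp: general_family_def tangent_family_def)
    then show ?thesis by (metis add.assoc add_self_left)
  qed
  have s: "polar x y = 1 + polar a x + polar a y" if "x \<in> A" "y \<in> A" "distinct [a, x, y]" for x y
  proof -
    have "polar a x + polar a y + polar x y = 1"
      using A mem that unfolding general_family_def triple_def by blast
    then show ?thesis by (metis add.assoc add.commute add_self_left)
  qed
  have p: "polar b c = 1 + polar a b + polar a c" "polar b d = 1 + polar a b + polar a d"
    "polar b e = 1 + polar a b + polar a e" "polar c d = 1 + polar a c + polar a d"
    "polar c e = 1 + polar a c + polar a e" "polar d e = 1 + polar a d + polar a e"
    using s mem dist by auto
  have q: "qf b = qf a + polar a b + (polar a b)\<^sup>2" "qf c = qf a + polar a c + (polar a c)\<^sup>2"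
    "qf d = qf a + polar a d + (polar a d)\<^sup>2" "qf e = qf a + polar a e + (polar a e)\<^sup>2"
    using t mem dist by auto
  have "f $ 0 = 1" using n0 mem by (simp add: f)
  moreover have "qf a + qf f = polar a f + (polar a f)\<^sup>2"
    by (simp add: f qf_add polar_bilinear p q char2_simps)
  ultimately show "tangent a f" using tangent_iff n0 mem by blast
  show "f \<noteq> a"
  proof
    assume "f = a"
    \<comment> \<open>By the definition of \<open>f\<close> the same pairing, of
      \<open>a + b\<close> with \<open>b + c + d + e\<close>, equals 1.\<close>
    then have "polar (a + b) (a + f) = 0" by simp
    then show False
      by (simp add: f polar_bilinear polar_commute[of b a] p char2_simps)
  qed
qed

text \<open>The sum is symmetric, so each of the five members can play the role of \<open>a\<close>
  in \<open>sixth_tangent\<close>; ellipticity passes to the sum along tangency.\<close>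

lemma general_5_extend:
  fixes a b c d e :: "'a ^ 5"
  assumes A: "general_family {a, b, c, d, e}" and dist: "distinct [a, b, c, d, e]"
  shows "tangent_family (insert (a + b + c + d + e) {a, b, c, d, e})" "a + b + c + d + e \<notin> {a, b, c, d, e}"
proof -
  let ?A = "{a, b, c, d, e}"
  define f where "f = a + b + c + d + e"
  note s = sixth_tangent[OF A, of _ _ _ _ _ f]
  have 1: "tangent a f \<and> f \<noteq> a" using s[of a b c d e] dist by (auto simp: f_def)
  have 2: "tangent b f \<and> f \<noteq> b" using s[of b a c d e] dist by (auto simp: f_def add_ac)
  have 3: "tangent c f \<and> f \<noteq> c" using s[of c a b d e] dist by (auto simp: f_def add_ac)
  have 4: "tangent d f \<and> f \<noteq> d" using s[of d a b c e] dist by (auto simp: f_def add_ac)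
  have 5: "tangent e f \<and> f \<noteq> e" using s[of e a b c d] dist by (auto simp: f_def add_ac)
  have n0: "x $ 0 = 1" if "x \<in> ?A" for x
    using A that unfolding general_family_def tangent_family_def by (blast intro: elliptic_covector_nth_0)
  have tf: "tangent_family ?A" using A by (simp add: general_family_def)
  then have "elliptic_covector a" by (simp add: tangent_family_def)
  moreover have "f $ 0 = 1" using n0 by (simp add: f_def)
  ultimately have "elliptic_covector f" using elliptic_covector_tangent 1 by blast
  moreover have "tangent x f" "tangent f x" if "x \<in> ?A" for x
    using that 1 2 3 4 5 tangent_commute[of f x] by auto
  ultimately have "tangent_family (insert f ?A)"
    using tf unfolding tangent_family_def by blast
  then show "tangent_family (insert (a + b + c + d + e) ?A)" by (simp only: f_def)
  have "f \<notin> ?A" using 1 2 3 4 5 by blast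
  then show "a + b + c + d + e \<notin> ?A" unfolding f_def .
qed

text \<open>On this solid the form is x1^2 + x1 x2 + x2^2 + x3 x4, a hyperbolic plane plus a binary
  form that is anisotropic when there is no primitive cube root of unity.\<close>

lemma elliptic_covector_11100:
  assumes no_root: "\<And>w::'a. w * w \<noteq> w + 1"
  shows "elliptic_covector (vec5 1 1 1 0 0 :: 'a ^ 5)"
proof -
  let ?a = "vec5 1 1 1 0 0 :: 'a ^ 5"
  have S: "x $ 0 = x $ 1 + x $ 2" if "x \<in> solid ?a" for x
    using that add_eq_0_iff_eq[of "x $ 0" "x $ 1 + x $ 2"] by (simp add: mem_solid dot_def add.assoc)
  have aniso: "y = 0 \<and> z = 0" if "y * y + y * z + z * z = 0" for y z :: 'a
  proof (rule ccontr)
    assume "\<not> ?thesis"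
    then have "z \<noteq> 0" using that by auto
    have "y * y = y * z + z * z" using that add_eq_0_iff_eq[of "y * y" "y * z + z * z"] by (simp add: add.assoc)
    then have "(y / z) * (y / z) = y / z + 1" using \<open>z \<noteq> 0\<close> by (simp add: field_simps)
    then show False using no_root by blast
  qed
  have qfS: "qf x = x $ 1 * x $ 1 + x $ 1 * x $ 2 + x $ 2 * x $ 2 + x $ 3 * x $ 4" if "x \<in> solid ?a" for x
    using S[OF that] by (simp add: qf_def char2_simps)
  have Z: "x $ 0 = 0 \<and> x $ 1 = 0 \<and> x $ 2 = 0" if "x \<in> solid ?a" "qf x = 0" "x $ 3 = 0" for x
    using aniso[of "x $ 1" "x $ 2"] qfS[of x] S[of x] that by auto
  have "\<exists>c. y = vsmult c x"
    if xy: "x \<in> solid ?a" "y \<in> solid ?a" "qf x = 0" "qf y = 0" "polar x y = 0" "x \<noteq> 0" for x y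
  proof (cases "x $ 3 = 0")
    case True
    have x: "x $ 0 = 0" "x $ 1 = 0" "x $ 2 = 0" using Z xy True by auto
    then have x4: "x $ 4 \<noteq> 0" using True xy(6) by (auto simp: vec5_eq_iff)
    then have y3: "y $ 3 = 0" using xy(5) x True by (simp add: polar_eq)
    have "y $ 0 = 0" "y $ 1 = 0" "y $ 2 = 0" using Z xy y3 by auto
    then show ?thesis
      using x x4 y3 True by (intro exI[of _ "y $ 4 / x $ 4"]) (simp add: vec5_eq_iff)
  next
    case False
    \<comment> \<open>This multiple of \<open>x\<close> clears coordinate 3 of \<open>y\<close>;
      anisotropy leaves only coordinate 4 of the remainder, and orthogonality to \<open>x\<close>
      kills that.\<close>
    define t where "t = y $ 3 / x $ 3"
    define m where "m = y + vsmult t x"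
    have "m $ 3 = 0" using False by (simp add: m_def t_def)
    moreover have "m \<in> solid ?a" using xy by (simp add: m_def solid_add solid_vsmult)
    moreover have "qf m = 0" using xy by (simp add: m_def qf_add qf_vsmult polar_bilinear polar_commute[of y])
    ultimately have m: "m $ 0 = 0" "m $ 1 = 0" "m $ 2 = 0" "m $ 3 = 0" using Z by auto
    have "polar x m = 0" using xy by (simp add: m_def polar_bilinear)
    then have "m $ 4 = 0" using m False by (simp add: polar_eq)
    then have "m = 0" using m by (simp add: vec5_eq_iff)
    then show ?thesis unfolding m_def vec_add_eq_0_iff by blast
  qed
  then show ?thesis by (auto simp: elliptic_covector_def)
qed

text \<open>Over the prime field t + t^2 = 0, so covectors with the same value of qf are automatically
  tangent; only one of them has to be checked to be elliptic.\<close>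

lemma nonlinear_5_clique_exists:
  assumes no_root: "\<And>w::'a. w * w \<noteq> w + 1"
  shows "\<exists>C :: ('a ^ 5) set set set. nonlinear_clique C \<and> card C = 5"
proof -
  define a b c d e :: "'a ^ 5"
    where v: "a = vec5 1 1 1 0 0" "b = vec5 1 1 1 1 0" "c = vec5 1 1 1 0 1"
      "d = vec5 1 0 0 1 1" "e = vec5 1 1 0 1 1"
  let ?A = "{a, b, c, d, e}"
  have n0: "x $ 0 = 1" if "x \<in> ?A" for x using that by (auto simp: v)
  have dist: "distinct [a, b, c, d, e]" by (simp add: v vec5_eq_iff)
  have prime_field: "qf x = 0 \<and> (\<forall>y\<in>?A. polar x y * polar x y = polar x y)" if "x \<in> ?A" for x
    using that by (auto simp: v qf_def polar_eq)
  have t: "tangent x y" if xy: "x \<in> ?A" "y \<in> ?A" for x y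
  proof -
    have "qf x = 0" "qf y = 0" "polar x y * polar x y = polar x y"
      using prime_field xy by blast+
    then show ?thesis
      unfolding tangent_iff[OF n0[OF xy(1)] n0[OF xy(2)]] by (simp only: power2_eq_square add_self)
  qed
  have a: "elliptic_covector a" unfolding v by (rule elliptic_covector_11100[OF no_root])
  have "elliptic_covector x" if "x \<in> ?A" for x
    using elliptic_covector_tangent[OF a n0[OF that]] t that by blast
  then have A: "tangent_family ?A" using t unfolding tangent_family_def by blast
  have "triple a b c \<noteq> 0" by (simp add: triple_def v polar_eq)
  then have "nonlinear_clique (ovoid ` ?A)"
    using nonlinear_clique_if_triple[OF A, of a b c] by blast
  moreover have "card (ovoid ` ?A) = 5"
    using tangent_family_clique(2)[OF A] dist by (subst card_image) auto
  ultimately show ?thesis by blast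
qed

end

section \<open>Cube roots of unity in finite fields\<close>

text \<open>Multiplication by a nonzero \<open>x\<close> permutes the nonzero elements; comparing
  products gives x^(q-1) = 1.\<close>

lemma finite_field_power_card:
  fixes x :: "'a::{field,finite}"
  shows "x ^ CARD('a) = x"
proof (cases "x = 0")
  case False
  let ?U = "UNIV - {0 :: 'a}"
  have "bij_betw ((*) x) ?U ?U"
    using False by (intro bij_betw_byWitness[where f' = "\<lambda>y. y / x"]) auto
  then have "(\<Prod>y\<in>?U. x * y) = \<Prod>?U"
    by (rule prod.reindex_bij_betw)
  then have "x ^ card ?U * \<Prod>?U = \<Prod>?U"
    by (simp add: prod.distrib)
  moreover have "\<Prod>?U \<noteq> 0" by simp
  ultimately have "x ^ card ?U = 1" by simp
  moreover have "CARD('a) = Suc (card ?U)"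
    by (simp add: card_Diff_singleton card_gt_0_iff)
  ultimately show ?thesis by (simp only: power_Suc mult_1_right)
qed simp

text \<open>Translation by 1 permutes the field; compare the sums of all elements.\<close>

lemma of_nat_card_field: "(of_nat CARD('a) :: 'a::{field,finite}) = 0"
proof -
  have "bij (\<lambda>x::'a. x + 1)"
    by (intro bij_betw_byWitness[where f' = "\<lambda>y. y - 1"]) auto
  then have "(\<Sum>x\<in>UNIV. x + 1) = (\<Sum>x\<in>UNIV. x :: 'a)"
    by (rule sum.reindex_bij_betw)
  then show ?thesis by (simp add: sum.distrib)
qed

context char2_field
begin

text \<open>Squaring interchanges \<open>w\<close> and \<open>w + 1\<close>, while n squarings fix
  every element of the field.\<close>

lemma cube_root_of_unity_even_power:
  assumes card: "CARD('a) = 2 ^ n" and w: "w * w = w + (1::'a)"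
  shows "even n"
proof -
  have "w ^ 2 ^ k = (if even k then w else w + 1)" for k
  proof (induction k)
    case (Suc k)
    have "w ^ 2 ^ Suc k = (w ^ 2 ^ k) * (w ^ 2 ^ k)"
      by (simp add: mult_2 power_add)
    then show ?case using Suc.IH w by (simp add: char2_simps)
  qed simp
  moreover have "w ^ 2 ^ n = w" using finite_field_power_card[of w] card by simp
  ultimately show ?thesis by (metis add_cancel_left_right zero_neq_one)
qed

text \<open>For even \<open>n\<close>, q = 3m + 1. At most m of the 3m nonzero elements satisfy y^m
  = 1, and for any other \<open>y\<close> the power y^m is a primitive cube root of unity.\<close>

lemma even_power_cube_root_of_unity:
  assumes card: "CARD('a) = 2 ^ n" and "n \<ge> 1" "even n"
  obtains w where "w * w = w + (1::'a)"
proof -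
  obtain k where k: "n = 2 * k" using \<open>even n\<close> by blast
  have "(4::nat) ^ k mod 3 = 1" by (simp add: power_mod[of 4 3 k, symmetric])
  moreover have "CARD('a) = 4 ^ k" using card k by (simp add: power_mult)
  ultimately have "CARD('a) mod 3 = 1" by simp
  then obtain m where m: "CARD('a) = 3 * m + 1"
    by (metis mult_div_mod_eq)
  have "CARD('a) > 1"
    unfolding card using \<open>n \<ge> 1\<close> by (intro one_less_power) simp_all
  then have "m > 0" using m by simp
  define p :: "'a poly" where "p = monom 1 m + 1"
  have "coeff p m \<noteq> 0" using \<open>m > 0\<close> by (simp add: p_def)
  then have "p \<noteq> 0" by auto
  moreover have "degree p \<le> m" unfolding p_def by (intro degree_add_le) (simp_all add: degree_monom_le)
  ultimately have c: "card {x. poly p x = 0} \<le> m" using card_poly_roots_bound[of p] by simp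
  obtain y :: 'a where y: "y \<noteq> 0" "y ^ m \<noteq> 1"
  proof (rule ccontr)
    assume "\<not> thesis"
    then have "UNIV - {0} \<subseteq> {x. poly p x = 0}"
      using that by (auto simp: p_def poly_monom add_eq_0_iff_eq)
    then have "card (UNIV - {0::'a}) \<le> card {x. poly p x = 0}" by (intro card_mono) simp_all
    then show False using c m \<open>m > 0\<close> by (simp add: card_Diff_singleton)
  qed
  define w where "w = y ^ m"
  have "y * (w * w * w) = y ^ CARD('a)"
    unfolding m by (simp add: w_def mult_ac flip: power_add power_Suc mult_2)
  then have "w * w * w = 1" using y finite_field_power_card[of y] by simp
  then have "(w + 1) * (w * w + (w + 1)) = 0" by (simp add: char2_simps)
  moreover have "w + 1 \<noteq> 0" using y by (simp add: w_def add_eq_0_iff_eq)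
  ultimately have "w * w = w + 1" by (simp only: mult_eq_0_iff add_eq_0_iff_eq simp_thms)
  then show ?thesis by (rule that)
qed

lemma nonlinear_clique_general_family:
  fixes C :: "('a ^ 5) set set set"
  assumes "nonlinear_clique C"
  obtains A where "general_family A" "C = ovoid ` A" "card A = card C"
proof -
  have "clique C" using assms by (simp add: nonlinear_clique_def)
  then obtain A where A: "tangent_family A" "C = ovoid ` A" "card A = card C"
    by (rule clique_tangent_family)
  then show ?thesis using nonlinear_imp_general assms that by metis
qed

end

theorem theorem3p11:
  fixes n :: nat
  assumes "CARD('a::{field,finite}) = 2 ^ n" and "n \<ge> 1"
  shows "((\<exists>C :: ('a ^ 5) set set set. nonlinear_clique C \<and> card C = 5) \<longleftrightarrow> odd n)
    \<and> (odd n \<longrightarrow> (\<forall>C :: ('a ^ 5) set set set. nonlinear_clique C \<and> card C = 5 \<longrightarrow>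
          (\<exists>D. clique D \<and> card D = 6 \<and> C \<subseteq> D)))
    \<and> (\<forall>(C :: ('a ^ 5) set set set) k. nonlinear_clique C \<and> card C = k \<and> k > 6 \<longrightarrow> False)"
proof -
  \<comment> \<open>The field has no zero divisors, so q = 0 in it yields 2 = 0.\<close>
  have "(2::'a) ^ n = 0"
    using of_nat_card_field[where 'a='a] assms(1) by simp
  then interpret char2_field "TYPE('a)"
    by unfold_locales simp
  have odd_no_root: "w * w \<noteq> w + 1" if "odd n" for w :: 'a
    using cube_root_of_unity_even_power[OF assms(1)] that by blast
  have five: "\<exists>a b c d e. A = {a, b, c, d, e} \<and> distinct [a, b, c, d, e]"
    if "card A = 5" for A :: "('a ^ 5) set"
  proof -
    obtain xs where "set xs = A" "distinct xs" using finite_distinct_list[of A] by auto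
    moreover from this have "length xs = 5" using that distinct_card by metis
    ultimately show ?thesis by (auto simp: numeral_eq_Suc length_Suc_conv) blast
  qed
  have "odd n" if C: "nonlinear_clique C" "card C = 5" for C :: "('a ^ 5) set set set"
  proof (rule ccontr)
    assume "\<not> odd n"
    then obtain w :: 'a where w: "w * w = w + 1"
      using even_power_cube_root_of_unity assms by blast
    obtain A where A: "general_family A" "C = ovoid ` A" "card A = card C"
      using nonlinear_clique_general_family[OF C(1)] .
    obtain a b c d e where "A = {a, b, c, d, e}" "distinct [a, b, c, d, e]"
      using five[OF A(3)[unfolded C(2)]] by blast
    then show False using general_5_no_cube_root[OF A(1), of a b c d e w] w by blast
  qed
  moreover have "\<exists>C :: ('a ^ 5) set set set. nonlinear_clique C \<and> card C = 5" if "odd n"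
    using nonlinear_5_clique_exists odd_no_root[OF that] by blast
  moreover have "\<exists>D. clique D \<and> card D = 6 \<and> C \<subseteq> D"
    if C: "nonlinear_clique C" "card C = 5" for C :: "('a ^ 5) set set set"
  proof -
    obtain A where A: "general_family A" "C = ovoid ` A" "card A = card C"
      using nonlinear_clique_general_family[OF C(1)] .
    obtain a b c d e where abcde: "A = {a, b, c, d, e}" "distinct [a, b, c, d, e]"
      using five[OF A(3)[unfolded C(2)]] by blast
    define B where "B = insert (a + b + c + d + e) A"
    have B: "tangent_family B" "card B = 6"
      using general_5_extend[OF A(1)[unfolded abcde(1)] abcde(2)] A(3) C(2)
      by (simp_all add: B_def abcde(1))
    have "clique (ovoid ` B)" "card (ovoid ` B) = 6"
      using tangent_family_clique[OF B(1)] B(2) by (simp_all add: card_image)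
    moreover have "C \<subseteq> ovoid ` B" by (auto simp: A(2) B_def)
    ultimately show ?thesis by blast
  qed
  moreover have False if C: "nonlinear_clique C" "card C > 6" for C :: "('a ^ 5) set set set"
  proof -
    obtain A where A: "general_family A" "C = ovoid ` A" "card A = card C"
      using nonlinear_clique_general_family[OF C(1)] .
    obtain A' where A': "A' \<subseteq> A" "card A' = 5"
      using obtain_subset_with_card_n[of 5 A] A(3) C(2) by auto
    obtain a b c d e where abcde: "A' = {a, b, c, d, e}" "distinct [a, b, c, d, e]"
      using five[OF A'(2)] by blast
    \<comment> \<open>Every member outside the chosen five is the same covector, so at most one is
      left.\<close>
    have "x = a + b + c + d + e" if "x \<in> A - A'" for x
      using general_6_eq_sum[OF A(1), of a b c d e x] that A'(1) abcde by auto
    then have "card (A - A') \<le> card {a + b + c + d + e}"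
      by (intro card_mono) auto
    moreover have "card (A - A') = card A - 5"
      using A' by (simp add: card_Diff_subset)
    ultimately show False using A(3) C(2) by simp
  qed
  ultimately show ?thesis by blast
qed

end
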